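(* Let $p$ be a prime and $n,h\in\{0,1,2,\ldots\}$. Let $G$ be a finite loopless undirected graph (parallel edges allowed) with $l$ vertices and edge set $\{1,\ldots,k\}$, in which every vertex has degree at most $2p^n-1$. Suppose $\{a_s(n_s)\}_{s=1}^k$ (with $a_s\in\mathbb Z$, $n_s\in\mathbb Z^+$) is an $(l(p^n-1)+p^h)$-cover of $\mathbb Z$. Then for any $m_1,\ldots,m_k\in\mathbb Z$ there is a subgraph $H$ of $G$ with nonempty edge set $E(H)$ such that every vertex of $H$ has degree exactly $p^n$ in $H$ (i.e., $H$ is $p^n$-regular) and $\sum_{s\in E(H)}m_s/n_s\in p^h\mathbb Z$.
   Context: For $a\in\mathbb Z$ and $n\in\mathbb Z^+$, $a(n)=a+n\mathbb Z$. For $A=\{a_s(n_s)\}_{s=1}^k$, $w_A(x)=|\{1\le s\le k: x\in a_s(n_s)\}|$; $A$ is an $m$-cover of $\mathbb Z$ if $w_A(x)\ge m$ for all $x\in\mathbb Z$. *)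

theory Defs
  imports Complex_Main "HOL-Computational_Algebra.Primes"
begin

text \<open>Undirected multigraphs: edges are abstract objects carrying a set of endpoints, so that
  distinct edges may be parallel.\<close>

record ('v, 'e) multigraph =
  verts :: "'v set"
  edges :: "'e set"
  ends :: "'e \<Rightarrow> 'v set"

text \<open>A loop would be an edge with a single endpoint; it is excluded by the cardinality condition.\<close>

definition finite_loopless_multigraph :: "('v, 'e) multigraph \<Rightarrow> bool" where
  "finite_loopless_multigraph G \<longleftrightarrow>
     finite (verts G) \<and> finite (edges G) \<and>
     (\<forall>e\<in>edges G. ends G e \<subseteq> verts G \<and> card (ends G e) = 2)"

text \<open>Each incident edge is counted once, which is the usual degree only in the absence of loops.\<close>

definition vertex_degree :: "('v, 'e) multigraph \<Rightarrow> 'v \<Rightarrow> nat" where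
  "vertex_degree G v = card {e \<in> edges G. v \<in> ends G e}"

definition subgraph :: "('v, 'e) multigraph \<Rightarrow> ('v, 'e) multigraph \<Rightarrow> bool" where
  "subgraph H G \<longleftrightarrow>
     verts H \<subseteq> verts G \<and> edges H \<subseteq> edges G \<and>
     (\<forall>e\<in>edges H. ends H e = ends G e \<and> ends H e \<subseteq> verts H)"

definition regular_multigraph :: "nat \<Rightarrow> ('v, 'e) multigraph \<Rightarrow> bool" where
  "regular_multigraph d H \<longleftrightarrow> (\<forall>v\<in>verts H. vertex_degree H v = d)"

definition residue_class :: "int \<Rightarrow> int \<Rightarrow> int set" where
  "residue_class a n = {a + n * j | j. True}"

text \<open>A system of residue classes is given by two functions \<open>a\<close> and \<open>n\<close>, of which only the values
  at \<open>1, \<dots>, k\<close> matter. Classes are counted by index, so repetitions count with multiplicity.\<close>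

definition covering_function :: "nat \<Rightarrow> (nat \<Rightarrow> int) \<Rightarrow> (nat \<Rightarrow> int) \<Rightarrow> int \<Rightarrow> nat" where
  "covering_function k a n x = card {s \<in> {1..k}. x \<in> residue_class (a s) (n s)}"

definition is_cover :: "nat \<Rightarrow> nat \<Rightarrow> (nat \<Rightarrow> int) \<Rightarrow> (nat \<Rightarrow> int) \<Rightarrow> bool" where
  "is_cover m k a n \<longleftrightarrow> (\<forall>x. m \<le> covering_function k a n x)"

end

theory Submission
  imports Defs "HOL-Library.Real_Mod" "HOL-Computational_Algebra.Polynomial"
begin

text \<open>Let \<open>\<theta>(I)\<close> be the sum of \<open>m\<^sub>s / n\<^sub>s\<close> over an edge set \<open>I\<close> and \<open>d\<^sub>v(I)\<close> the number of edges of \<open>I\<close> at \<open>v\<close>.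
  Put \<open>f(I) = (\<Prod>v. binom(d\<^sub>v(I) - 1, p^n - 1)) * binom(\<theta>(I) - 1, p^h - 1)\<close>, a polynomial in the indicator
  variables of \<open>I\<close> of degree at most \<open>l(p^n - 1) + p^h - 1\<close>, less than the multiplicity of the cover.
  For an integer \<open>x\<close> let \<open>z\<^sub>s = e((a\<^sub>s + x) m\<^sub>s / n\<^sub>s)\<close>. At least as many \<open>z\<^sub>s\<close> equal 1 as the cover multiplicity
  at \<open>-x\<close>, so the sum over all \<open>I\<close> of \<open>(-1)^|I| f(I) \<Prod>\<^bsub>s\<in>I\<^esub> z\<^sub>s\<close> vanishes. Averaging over \<open>x\<close> leaves only the
  terms with integral \<open>\<theta>(I)\<close>, where \<open>f(I)\<close> is an integer, divisible by \<open>p\<close> unless \<open>p^n\<close> divides every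
  \<open>d\<^sub>v(I)\<close> and \<open>p^h\<close> divides \<open>\<theta>(I)\<close>. Since \<open>f({})\<close> is 1 or -1 and \<open>p\<close> is not a unit among the algebraic
  integers, some nonempty \<open>I\<close> contributes a term not divisible by \<open>p\<close>. There the degrees are multiples
  of \<open>p^n\<close> below \<open>2p^n\<close>.\<close>

section \<open>Vanishing of signed subset sums\<close>

text \<open>Induction on the number of linear factors. With none, the sum is the product of all
  \<open>1 - z s\<close>, which has a zero factor. Expanding the factor for \<open>j\<close> leaves
  sums over the subsets containing a fixed \<open>s\<close>; deleting \<open>s\<close> absorbs
  \<open>w i s\<close> into \<open>b i\<close> and loses at most one index with
  \<open>z s = 1\<close>, affordable because \<open>T\<close> has one factor fewer.\<close>

lemma subset_sum_eq_0:
  fixes z :: "'b \<Rightarrow> 'c :: comm_ring_1" and b :: "'i \<Rightarrow> 'c" and w :: "'i \<Rightarrow> 'b \<Rightarrow> 'c"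
  assumes "finite T" "finite U" "card T < card {s\<in>U. z s = 1}"
  shows "(\<Sum>I\<in>Pow U. (\<Prod>s\<in>I. - z s) * (\<Prod>i\<in>T. b i + (\<Sum>s\<in>I. w i s))) = 0"
  using assms
proof (induction T arbitrary: U b rule: finite_induct)
  case empty
  from empty.prems(2) obtain s where "s \<in> U" "z s = 1"
    by (metis (mono_tags, lifting) card.empty empty_Collect_eq less_irrefl)
  then have "(\<Prod>s\<in>U. - z s + 1) = 0"
    using empty.prems(1) by (intro prod_zero) auto
  then show ?case
    using prod_add[OF empty.prems(1), of "\<lambda>s. - z s" "\<lambda>_. 1"] by simp
next
  case (insert j T)
  define P where "P = (\<lambda>b I. (\<Prod>s\<in>I. - z s) * (\<Prod>i\<in>T. b i + (\<Sum>s\<in>I. w i s)))"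
  have IH: "(\<Sum>I\<in>Pow U'. P b' I) = 0" if "finite U'" "card T < card {s\<in>U'. z s = 1}" for U' b'
    using insert.IH that by (simp add: P_def)
  have containing: "(\<Sum>I | I \<subseteq> U \<and> s \<in> I. P b I) = 0" if s: "s \<in> U" for s
  proof -
    have "(\<Sum>I | I \<subseteq> U \<and> s \<in> I. P b I) = (\<Sum>I\<in>Pow (U - {s}). P b (insert s I))"
      by (rule sum.reindex_bij_witness[of _ "insert s" "\<lambda>I. I - {s}"]) (use s in \<open>auto simp: insert_absorb\<close>)
    also have "\<dots> = (\<Sum>I\<in>Pow (U - {s}). - z s * P (\<lambda>i. b i + w i s) I)"
    proof (rule sum.cong[OF refl])
      fix I assume "I \<in> Pow (U - {s})"
      then have "s \<notin> I" "finite I"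
        using insert.prems(1) by (auto intro: finite_subset)
      then show "P b (insert s I) = - z s * P (\<lambda>i. b i + w i s) I"
        by (simp add: P_def add.assoc)
    qed
    also have "\<dots> = 0"
    proof -
      have "{x \<in> U - {s}. z x = 1} = {x \<in> U. z x = 1} - {s}" by auto
      then have "card {x \<in> U. z x = 1} - 1 \<le> card {x \<in> U - {s}. z x = 1}"
        by (metis diff_card_le_card_Diff finite.emptyI finite.insertI card.empty card_insert_disjoint empty_iff One_nat_def)
      then have "card T < card {x \<in> U - {s}. z x = 1}"
        using insert.prems(2) insert.hyps by simp
      with IH[of "U - {s}"] insert.prems(1) show ?thesis
        by (simp only: flip: sum_distrib_left) simp
    qed
    finally show ?thesis .
  qed
  have "(\<Sum>I\<in>Pow U. P b I * (\<Sum>s\<in>I. w j s)) = (\<Sum>I\<in>Pow U. \<Sum>s\<in>U. if s \<in> I then P b I * w j s else 0)"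
  proof (rule sum.cong[OF refl])
    fix I assume "I \<in> Pow U"
    then have "{s\<in>U. s \<in> I} = I" by auto
    then show "P b I * (\<Sum>s\<in>I. w j s) = (\<Sum>s\<in>U. if s \<in> I then P b I * w j s else 0)"
      using insert.prems(1) by (simp add: sum_distrib_left flip: sum.inter_filter)
  qed
  also have "\<dots> = (\<Sum>s\<in>U. w j s * (\<Sum>I | I \<subseteq> U \<and> s \<in> I. P b I))"
    using insert.prems(1)
    by (subst sum.swap) (auto simp: sum_distrib_left mult.commute simp flip: sum.inter_filter intro!: sum.cong)
  also have "\<dots> = 0"
    by (simp add: containing)
  finally have "(\<Sum>I\<in>Pow U. b j * P b I + P b I * (\<Sum>s\<in>I. w j s)) = 0"
    using IH[of U b] insert by (simp add: sum.distrib flip: sum_distrib_left)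
  then show ?case
    using insert.hyps by (simp add: P_def algebra_simps)
qed

section \<open>Filtering by divisibility with roots of unity\<close>

lemma cis_powi_eq_1_iff:
  assumes "M > 0"
  shows "cis (2 * pi / of_nat M) powi t = 1 \<longleftrightarrow> int M dvd t"
proof -
  have "cis (2 * pi / of_nat M) powi t = 1 \<longleftrightarrow> (\<exists>j. of_int t * (2 * pi / of_nat M) = of_int j * (2 * pi))"
    by (simp add: cis_power_int cis_eq_1_iff)
  also have "\<dots> \<longleftrightarrow> (\<exists>j. real_of_int t = real_of_int (int M * j))"
    using assms by (simp add: field_simps)
  also have "\<dots> \<longleftrightarrow> int M dvd t"
    by (metis dvd_def of_int_eq_iff)
  finally show ?thesis .
qed

text \<open>Summing the hypothesis over \<open>x < M\<close> turns each power into a geometric sum,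
  equal to \<open>M\<close> if \<open>int M dvd t I\<close> and to 0 otherwise.\<close>

lemma sum_filter_dvd_eq_0:
  assumes "M > 0" "finite S"
    and "\<And>x::nat. (\<Sum>I\<in>S. C I * (cis (2 * pi / of_nat M) powi t I) ^ x) = 0"
  shows "(\<Sum>I | I \<in> S \<and> int M dvd t I. C I) = 0"
proof -
  let ?\<zeta> = "cis (2 * pi / of_nat M)"
  have geometric: "(\<Sum>x<M. (?\<zeta> powi t) ^ x) = (if int M dvd t then of_nat M else 0)" for t
  proof (cases "int M dvd t")
    case True
    then have "?\<zeta> powi t = 1" using cis_powi_eq_1_iff[OF assms(1)] by blast
    then show ?thesis using True by simp
  next
    case False
    then have "?\<zeta> powi t \<noteq> 1" using cis_powi_eq_1_iff[OF assms(1)] by blast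
    moreover have "(?\<zeta> powi t) ^ M = 1"
      using cis_powi_eq_1_iff[OF assms(1), of "t * int M"] by (simp add: power_int_power')
    ultimately show ?thesis using False by (simp add: geometric_sum)
  qed
  have "0 = (\<Sum>x<M. \<Sum>I\<in>S. C I * (?\<zeta> powi t I) ^ x)"
    by (simp add: assms(3))
  also have "\<dots> = (\<Sum>I\<in>S. C I * (\<Sum>x<M. (?\<zeta> powi t I) ^ x))"
    by (subst sum.swap) (simp add: sum_distrib_left)
  also have "\<dots> = (\<Sum>I\<in>S. if int M dvd t I then of_nat M * C I else 0)"
    unfolding geometric by (intro sum.cong) auto
  also have "\<dots> = of_nat M * (\<Sum>I | I \<in> S \<and> int M dvd t I. C I)"
    using assms(2) by (simp add: sum.inter_filter sum_distrib_left if_distrib cong: if_cong)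
  finally show ?thesis using assms(1) by simp
qed

text \<open>The product of the \<open>z s\<close> over \<open>I\<close> splits into a factor free of
  \<open>x\<close> and the \<open>x\<close>-th power of a root of unity with exponent
  \<open>sum c I\<close>, so vanishing for every \<open>x\<close> feeds the divisibility
  filter.\<close>

lemma weighted_sum_eq_0:
  fixes a c :: "'b \<Rightarrow> int" and b :: "'i \<Rightarrow> complex" and w :: "'i \<Rightarrow> 'b \<Rightarrow> complex"
  assumes "M > 0" "finite T" "finite U"
    and cover: "\<And>x::int. card T < card {s\<in>U. int M dvd (a s + x) * c s}"
  shows "(\<Sum>I | I \<in> Pow U \<and> int M dvd sum c I.
           (-1) ^ card I * cis (2 * pi / of_nat M) powi (\<Sum>s\<in>I. a s * c s) *
             (\<Prod>i\<in>T. b i + (\<Sum>s\<in>I. w i s))) = 0"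
proof (rule sum_filter_dvd_eq_0)
  let ?\<zeta> = "cis (2 * pi / of_nat M)"
  let ?Q = "\<lambda>I. \<Prod>i\<in>T. b i + (\<Sum>s\<in>I. w i s)"
  fix x :: nat
  define z where "z = (\<lambda>s. ?\<zeta> powi ((a s + int x) * c s))"
  have prod_powi: "(\<Prod>s\<in>I. ?\<zeta> powi f s) = ?\<zeta> powi sum f I" if "finite I" for f :: "'b \<Rightarrow> int" and I
    using that by (induction I rule: finite_induct) (simp_all add: power_int_add)
  have "(\<Sum>I\<in>Pow U. (-1) ^ card I * ?\<zeta> powi (\<Sum>s\<in>I. a s * c s) * ?Q I * (?\<zeta> powi sum c I) ^ x) =
        (\<Sum>I\<in>Pow U. (\<Prod>s\<in>I. - z s) * ?Q I)"
  proof (rule sum.cong[OF refl])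
    fix I assume "I \<in> Pow U"
    then have "finite I" using assms(3) by (auto intro: finite_subset)
    then have "(\<Prod>s\<in>I. - z s) = (-1) ^ card I * ?\<zeta> powi ((\<Sum>s\<in>I. a s * c s) + sum c I * int x)"
      using prod_powi[of I "\<lambda>s. (a s + int x) * c s"]
      by (simp add: prod_uminus z_def distrib_right sum.distrib sum_distrib_right mult.commute[of "int x"])
    also have "\<dots> = (-1) ^ card I * ?\<zeta> powi (\<Sum>s\<in>I. a s * c s) * (?\<zeta> powi sum c I) ^ x"
      by (simp add: power_int_add power_int_power')
    finally show "(-1) ^ card I * ?\<zeta> powi (\<Sum>s\<in>I. a s * c s) * ?Q I * (?\<zeta> powi sum c I) ^ x =
        (\<Prod>s\<in>I. - z s) * ?Q I" by simp
  qed
  also have "\<dots> = 0"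
    using cover[of "int x"] cis_powi_eq_1_iff[OF assms(1)]
    by (intro subset_sum_eq_0) (use assms in \<open>auto simp: z_def\<close>)
  finally show "(\<Sum>I\<in>Pow U. (-1) ^ card I * ?\<zeta> powi (\<Sum>s\<in>I. a s * c s) * ?Q I * (?\<zeta> powi sum c I) ^ x) = 0" .
qed (use assms in auto)

section \<open>Binomial coefficients modulo a prime\<close>

text \<open>\<open>gchoose\<close> itself cannot be written at type \<open>int\<close> here: its sort constraint is that of fields.\<close>

definition int_gbinomial :: "int \<Rightarrow> nat \<Rightarrow> int" where
  "int_gbinomial z k = pochhammer (z - int k + 1) k div fact k"

lemma of_int_int_gbinomial:
  "of_int (int_gbinomial z k) = (of_int z gchoose k :: 'a :: field_char_0)"
  by (simp add: int_gbinomial_def of_int_gbinomial flip: gbinomial_int_pochhammer')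

text \<open>Needed for the empty edge set, where every upper argument is \<open>- 1\<close>.\<close>

lemma int_gbinomial_minus_one: "int_gbinomial (- 1) k = (- 1) ^ k"
  using uminus_one_gbinomial[of k] by (simp only: int_gbinomial_def gbinomial_int_pochhammer')

text \<open>By absorption, \<open>p ^ n\<close> divides \<open>z\<close> times the binomial
  coefficient. Since \<open>z\<close> cannot take up all \<open>n\<close> factors \<open>p\<close>,
  one is left for the coefficient.\<close>

lemma prime_dvd_int_gbinomial:
  fixes p n :: nat and z :: int
  assumes "prime p" "\<not> int (p ^ n) dvd z"
  shows "int p dvd int_gbinomial (z - 1) (p ^ n - 1)"
proof -
  have pos: "p ^ n > 0" using assms(1) by (simp add: prime_gt_0_nat)
  have "of_int (int (p ^ n) * int_gbinomial z (p ^ n)) = (of_int (z * int_gbinomial (z - 1) (p ^ n - 1)) :: rat)"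
    using gbinomial_absorption[of "p ^ n - 1" "of_int z :: rat"] pos
    by (simp add: of_int_int_gbinomial)
  then have "int p ^ n dvd z * int_gbinomial (z - 1) (p ^ n - 1)"
    unfolding of_int_eq_iff by (metis dvd_triv_left of_nat_power)
  then obtain i j where ij: "i + j = n" "int p ^ i dvd z" "int p ^ j dvd int_gbinomial (z - 1) (p ^ n - 1)"
    using assms(1) prime_elem_power_dvd_prod[of "int p" n z "int_gbinomial (z - 1) (p ^ n - 1)"] by (meson prime_imp_prime_elem prime_nat_int_transfer)
  have "j \<noteq> 0"
    using ij(1,2) assms(2) by (intro notI) simp
  then show ?thesis
    using ij(3) by (meson dvd_power dvd_trans gr0I)
qed

section \<open>Integer polynomials at algebraic integers\<close>

lemma poly_map_poly_of_int_add:
  "poly (map_poly of_int (q + r)) x = poly (map_poly of_int q) x + poly (map_poly of_int r) (x :: 'a :: comm_ring_1)"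
proof -
  have "map_poly of_int (q + r) = map_poly of_int q + (map_poly of_int r :: 'a poly)"
    by (intro poly_eqI) (simp add: coeff_map_poly)
  then show ?thesis by simp
qed

lemma poly_map_poly_of_int_mult:
  "poly (map_poly of_int (q * r)) x = poly (map_poly of_int q) x * poly (map_poly of_int r) (x :: 'a :: comm_ring_1)"
proof -
  have "map_poly of_int (q * r) = map_poly of_int q * (map_poly of_int r :: 'a poly)"
    by (intro poly_eqI) (simp add: coeff_map_poly coeff_mult)
  then show ?thesis by simp
qed

lemma poly_map_poly_of_int_smult:
  "poly (map_poly of_int (smult a q)) x = of_int a * poly (map_poly of_int q) (x :: 'a :: comm_ring_1)"
  using poly_map_poly_of_int_mult[of "[:a:]" q x] by (simp add: map_poly_pCons)

lemma poly_map_poly_of_int_power: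
  "poly (map_poly of_int (q ^ t)) x = poly (map_poly of_int q) (x :: 'a :: comm_ring_1) ^ t"
  by (induction t) (simp_all add: poly_map_poly_of_int_mult)

lemma poly_map_poly_of_int_sum_monom:
  "poly (map_poly of_int (\<Sum>i\<in>J. monom (b i) (e i))) x = (\<Sum>i\<in>J. of_int (b i) * (x :: 'a :: comm_ring_1) ^ e i)"
  by (induction J rule: infinite_finite_induct)
    (simp_all add: poly_map_poly_of_int_add map_poly_monom poly_monom)

text \<open>Let \<open>g\<close> be a nonzero integer polynomial of least degree with root \<open>x\<close>. Reducing \<open>q^t\<close> modulo a monic
  polynomial with root \<open>x\<close> first bounds its degree, so that one constant \<open>D\<close> serves all \<open>t\<close>: \<open>D * q(x)^t\<close> is
  the value at \<open>x\<close> of an integer polynomial of smaller degree than \<open>g\<close>. By minimality \<open>p^t\<close> divides \<open>D * c^t\<close>.\<close>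

lemma prime_dvd_of_algebraic_int:
  fixes x :: "'a :: field_char_0" and p c :: int
  assumes "prime p" "algebraic_int x" and c: "of_int c = of_int p * poly (map_poly of_int q) x"
  shows "p dvd c"
proof (rule ccontr)
  assume "\<not> p dvd c"
  define ev where "ev q = poly (map_poly of_int q) x" for q
  note ev_simps = poly_map_poly_of_int_add[of _ _ x, folded ev_def] poly_map_poly_of_int_mult[of _ _ x, folded ev_def]
    poly_map_poly_of_int_smult[of _ _ x, folded ev_def] poly_map_poly_of_int_power[of _ _ x, folded ev_def]
  have ev_const: "ev [:a:] = of_int a" for a
    by (simp add: ev_def map_poly_pCons)
  have ev_degree_pos: "degree r > 0" if "r \<noteq> 0" "ev r = 0" for r
    using that ev_const by (metis degree_eq_zeroE gr0I of_int_eq_0_iff pCons_0_0)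
  obtain P :: "int poly" where P: "ev P = 0" "lead_coeff P = 1"
    using assms(2) unfolding algebraic_int_altdef_ipoly ev_def by blast
  then have "P \<noteq> 0" by auto
  obtain g where g: "g \<noteq> 0" "ev g = 0"
    and least: "\<And>r. r \<noteq> 0 \<Longrightarrow> ev r = 0 \<Longrightarrow> degree g \<le> degree r"
    using ex_has_least_nat[of "\<lambda>r. r \<noteq> 0 \<and> ev r = 0" P degree] P \<open>P \<noteq> 0\<close> by blast
  define D where "D = lead_coeff g ^ degree P"
  have "p ^ t dvd D" for t
  proof (cases "t = 0")
    case False
    obtain u r where "pseudo_divmod (q ^ t) P = (u, r)" by fastforce
    from pseudo_divmod[OF \<open>P \<noteq> 0\<close> this] have "q ^ t = P * u + r" and r: "r = 0 \<or> degree r < degree P"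
      using P(2) by auto
    then have "ev (q ^ t) = ev P * ev u + ev r"
      by (simp only: ev_simps(1,2))
    then have ev_r: "ev r = ev q ^ t"
      using P(1) by (simp add: ev_simps)
    \<comment> \<open>The exponent of the leading coefficient in pseudo-division by
      \<open>g\<close>. For \<open>r = 0\<close> it is at most 1, so its bound by
      \<open>degree P\<close> uses \<open>degree P > 0\<close>.\<close>
    define e where "e = Suc (degree r) - degree g"
    have "e \<le> degree P"
      using r ev_degree_pos[OF \<open>P \<noteq> 0\<close> P(1)] by (auto simp: e_def)
    obtain v s where "pseudo_divmod r g = (v, s)" by fastforce
    from pseudo_divmod[OF g(1) this] have "smult (lead_coeff g ^ e) r = g * v + s"
      and s: "s = 0 \<or> degree s < degree g"
      by (auto simp: e_def)
    then have "of_int (lead_coeff g ^ e) * ev r = ev g * ev v + ev s"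
      by (simp only: ev_simps(1,2) flip: ev_simps(3))
    then have ev_s: "of_int (lead_coeff g ^ e) * ev r = ev s"
      using g(2) by simp
    \<comment> \<open>Pads the power of the leading coefficient to \<open>D\<close>, which is free
      of \<open>t\<close>.\<close>
    define f where "f = lead_coeff g ^ (degree P - e)"
    have D: "D = f * lead_coeff g ^ e"
      using \<open>e \<le> degree P\<close> by (simp add: D_def f_def flip: power_add)
    have "of_int (D * c ^ t) = of_int (p ^ t * f) * ev s"
      using c by (simp add: D power_mult_distrib ac_simps ev_r flip: ev_s ev_def)
    then have "ev (smult (p ^ t * f) s + [:- (D * c ^ t):]) = 0"
      by (simp add: ev_simps ev_const)
    moreover have "degree (smult (p ^ t * f) s + [:- (D * c ^ t):]) < degree g"
      using s ev_degree_pos[OF g] by (intro degree_add_less) (auto intro: le_less_trans[OF degree_smult_le])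
    ultimately have "smult (p ^ t * f) s + [:- (D * c ^ t):] = 0"
      using least leD by blast
    then have "coeff (smult (p ^ t * f) s + [:- (D * c ^ t):]) 0 = 0"
      by simp
    then have "c ^ t * D = p ^ t * (f * coeff s 0)"
      by (simp add: ac_simps)
    then have "p ^ t dvd c ^ t * D" by simp
    moreover have "\<not> p dvd c ^ t"
      using \<open>\<not> p dvd c\<close> assms(1) prime_dvd_power by blast
    ultimately show ?thesis
      using assms(1) False prime_power_dvd_multD[of p t "c ^ t" D] by auto
  qed simp
  moreover have "D \<noteq> 0" using g(1) by (simp add: D_def)
  moreover have "\<not> is_unit p" using assms(1) by auto
  \<comment> \<open>A nonzero integer has only finitely many powers of a nonunit as
    divisors.\<close>
  ultimately show False
    using finite_divisor_powers[of D p] by simp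
qed

section \<open>A nonempty index set surviving modulo p\<close>

text \<open>Otherwise the vanishing sum would write \<open>F {}\<close> as \<open>p\<close> times an
  integer polynomial in a root of unity, forcing \<open>p dvd F {}\<close>. The constant
  \<open>K\<close> is there to carry the factorial denominators of the binomials.\<close>

lemma exists_nonempty_not_dvd:
  fixes a c :: "'b \<Rightarrow> int" and b :: "'i \<Rightarrow> complex" and w :: "'i \<Rightarrow> 'b \<Rightarrow> complex" and p :: int
  assumes "prime p" "M > 0" "finite T" "finite U"
    and cover: "\<And>x::int. card T < card {s\<in>U. int M dvd (a s + x) * c s}"
    and F: "\<And>I. I \<subseteq> U \<Longrightarrow> int M dvd sum c I \<Longrightarrow> of_int (F I) = K * (\<Prod>i\<in>T. b i + (\<Sum>s\<in>I. w i s))"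
    and F_empty: "\<not> p dvd F {}"
  obtains I where "I \<subseteq> U" "I \<noteq> {}" "int M dvd sum c I" "\<not> p dvd F I"
proof (rule ccontr)
  assume "\<not> thesis"
  with that have dvd: "p dvd F I" if "I \<subseteq> U" "I \<noteq> {}" "int M dvd sum c I" for I
    using \<open>I \<subseteq> U\<close> \<open>I \<noteq> {}\<close> \<open>int M dvd sum c I\<close> by blast
  let ?\<zeta> = "cis (2 * pi / of_nat M)"
  define S where "S = {I \<in> Pow U. int M dvd sum c I}"
  \<comment> \<open>Reduction modulo \<open>M\<close> gives natural exponents, as evaluation of a
    polynomial requires; \<open>E {}\<close> is 0.\<close>
  define E where "E = (\<lambda>I. nat ((\<Sum>s\<in>I. a s * c s) mod int M))"
  have "finite S" using assms(4) by (simp add: S_def)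
  have "{} \<in> S" by (simp add: S_def)
  have \<zeta>_power: "?\<zeta> ^ M = 1"
    using cis_powi_eq_1_iff[OF assms(2), of "int M"] by simp
  have E: "?\<zeta> powi (\<Sum>s\<in>I. a s * c s) = ?\<zeta> ^ E I" for I
  proof -
    let ?y = "\<Sum>s\<in>I. a s * c s"
    have "?\<zeta> powi ?y = ?\<zeta> powi (int M * (?y div int M)) * ?\<zeta> powi (?y mod int M)"
      by (simp flip: power_int_add)
    also have "?\<zeta> powi (int M * (?y div int M)) = 1"
      using \<zeta>_power by (simp add: power_int_mult)
    finally show ?thesis
      using assms(2) by (simp add: E_def power_int_nonneg_exp)
  qed
  have "(\<Sum>I\<in>S. (-1) ^ card I * ?\<zeta> ^ E I * of_int (F I)) =
      K * (\<Sum>I\<in>S. (-1) ^ card I * ?\<zeta> ^ E I * (\<Prod>i\<in>T. b i + (\<Sum>s\<in>I. w i s)))"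
    unfolding sum_distrib_left by (rule sum.cong) (auto simp: S_def F)
  also have "\<dots> = 0"
    using weighted_sum_eq_0[OF assms(2-4) cover, of b w] by (simp add: S_def E)
  finally have "(-1) ^ card {} * ?\<zeta> ^ E {} * of_int (F {}) =
      - (\<Sum>I\<in>S - {{}}. (-1) ^ card I * ?\<zeta> ^ E I * of_int (F I))"
    using sum.remove[OF \<open>finite S\<close> \<open>{} \<in> S\<close>, of "\<lambda>I. (-1) ^ card I * ?\<zeta> ^ E I * of_int (F I)"]
    by (simp add: eq_neg_iff_add_eq_0)
  also have "\<dots> = of_int p * (\<Sum>I\<in>S - {{}}. of_int (- ((-1) ^ card I) * (F I div p)) * ?\<zeta> ^ E I)"
    unfolding sum_distrib_left sum_negf[symmetric]
  proof (rule sum.cong[OF refl])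
    fix I assume "I \<in> S - {{}}"
    then have "F I = p * (F I div p)" using dvd by (simp add: S_def)
    then have "(of_int (F I) :: complex) = of_int p * of_int (F I div p)" by (metis of_int_mult)
    then show "- ((-1) ^ card I * ?\<zeta> ^ E I * of_int (F I)) =
        of_int p * (of_int (- ((-1) ^ card I) * (F I div p)) * ?\<zeta> ^ E I)"
      by simp
  qed
  finally have "of_int (F {}) = of_int p * poly (map_poly of_int
      (\<Sum>I\<in>S - {{}}. monom (- ((-1) ^ card I) * (F I div p)) (E I))) ?\<zeta>"
    by (simp only: poly_map_poly_of_int_sum_monom) (simp add: E_def)
  moreover have "algebraic_int ?\<zeta>"
    by (rule algebraic_int_root[of 1 "monom 1 M"])
      (use assms(2) \<zeta>_power in \<open>auto simp: poly_monom degree_monom_eq coeff_monom\<close>)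
  ultimately show False
    using prime_dvd_of_algebraic_int[OF assms(1)] F_empty by blast
qed

section \<open>Application to the graph\<close>

text \<open>The type is generic because the weights are complex while the conclusion is
  rational.\<close>

lemma sum_of_int_divide_common:
  fixes D :: int and m N :: "'b \<Rightarrow> int"
  assumes "D \<noteq> 0" "\<And>s. s \<in> I \<Longrightarrow> N s dvd D"
  shows "(\<Sum>s\<in>I. of_int (m s) / of_int (N s)) = (of_int (\<Sum>s\<in>I. m s * (D div N s)) / of_int D :: 'a :: field_char_0)"
proof -
  have "of_int (m s) / of_int (N s) = (of_int (m s * (D div N s)) / of_int D :: 'a)" if "s \<in> I" for s
  proof -
    obtain q where q: "D = N s * q" using assms(2) \<open>s \<in> I\<close> by (meson dvdE)
    with assms(1) show ?thesis by simp
  qed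
  then show ?thesis
    by (simp add: sum_divide_distrib)
qed

theorem theorem2p3:
  fixes p n h k l :: nat
    and G :: "('v, nat) multigraph"
    and a N m :: "nat \<Rightarrow> int"
  assumes "prime p"
    and "finite_loopless_multigraph G"
    and "card (verts G) = l"
    and "edges G = {1..k}"
    and "\<forall>v\<in>verts G. vertex_degree G v \<le> 2 * p ^ n - 1"
    and "\<forall>s\<in>{1..k}. N s > 0"
    and "is_cover (l * (p ^ n - 1) + p ^ h) k a N"
  shows "\<exists>H. subgraph H G \<and> edges H \<noteq> {} \<and> regular_multigraph (p ^ n) H \<and>
           (\<exists>z::int. (\<Sum>s\<in>edges H. (of_int (m s) / of_int (N s) :: rat)) = of_nat (p ^ h) * of_int z)"
proof -
  define U where "U = {1..k}"
  \<comment> \<open>A common denominator: \<open>m s / N s\<close> equals \<open>c s / M\<close>, so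
    integral sums are those with \<open>int M dvd sum c I\<close>.\<close>
  define M where "M = nat (\<Prod>s\<in>U. N s)"
  define c where "c = (\<lambda>s. m s * (int M div N s))"
  define d where "d = (\<lambda>I v. card {s\<in>I. v \<in> ends G s})"
  have "finite U" by (simp add: U_def)
  have "finite (verts G)" using assms(2) by (simp add: finite_loopless_multigraph_def)
  have p_pos: "p ^ i > 0" for i using assms(1) by (simp add: prime_gt_0_nat)
  have N_pos: "N s > 0" if "s \<in> U" for s using assms(6) that by (simp add: U_def)
  have "(\<Prod>s\<in>U. N s) > 0" using N_pos by (simp add: prod_pos)
  then have "M > 0" and int_M: "int M = (\<Prod>s\<in>U. N s)" by (simp_all add: M_def)
  have N_dvd: "N s dvd int M" if "s \<in> U" for s
    using that \<open>finite U\<close> by (simp add: int_M dvd_prodI)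
  have sum_c: "(\<Sum>s\<in>I. of_int (m s) / of_int (N s)) = (of_int (sum c I) / of_nat M :: complex)"
    "(\<Sum>s\<in>I. of_int (m s) / of_int (N s)) = (of_int (sum c I) / of_nat M :: rat)" if "I \<subseteq> U" for I
    using sum_of_int_divide_common[of "int M" I N m] that \<open>M > 0\<close> N_dvd by (auto simp: c_def)
  \<comment> \<open>One index per linear factor of the numerators of the binomials:
    \<open>p ^ n - 1\<close> for each vertex and \<open>p ^ h - 1\<close> for the fractional sum,
    one less in total than the cover multiplicity.\<close>
  define T :: "('v \<times> nat + nat) set" where "T = (verts G \<times> {0..<p ^ n - 1}) <+> {0..<p ^ h - 1}"
  define b :: "'v \<times> nat + nat \<Rightarrow> complex" where
    "b = case_sum (\<lambda>(v, j). - 1 - of_nat j) (\<lambda>j. - 1 - of_nat j)"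
  define w :: "'v \<times> nat + nat \<Rightarrow> nat \<Rightarrow> complex" where
    "w = case_sum (\<lambda>(v, j) s. of_bool (v \<in> ends G s)) (\<lambda>j s. of_int (m s) / of_int (N s))"
  \<comment> \<open>The \<open>div\<close> is exact on the sets \<open>I\<close> that matter, those
    with \<open>int M dvd sum c I\<close>.\<close>
  define F where "F = (\<lambda>I. (\<Prod>v\<in>verts G. int_gbinomial (int (d I v) - 1) (p ^ n - 1)) *
    int_gbinomial (sum c I div int M - 1) (p ^ h - 1))"
  have "finite T" using \<open>finite (verts G)\<close> by (simp add: T_def)
  have "card T = l * (p ^ n - 1) + (p ^ h - 1)"
    using \<open>finite (verts G)\<close> assms(3) by (simp add: T_def card_Plus card_cartesian_product)
  then have card_T: "card T < l * (p ^ n - 1) + p ^ h" using p_pos[of h] by simp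
  have cover: "card T < card {s\<in>U. int M dvd (a s + x) * c s}" for x
  proof -
    \<comment> \<open>If \<open>- x\<close> lies in the class of \<open>s\<close>, then
      \<open>N s\<close> divides \<open>a s + x\<close> and cancels the denominator of
      \<open>m s / N s\<close>.\<close>
    have "int M dvd (a s + x) * c s" if s: "s \<in> U" "- x \<in> residue_class (a s) (N s)" for s
    proof -
      obtain j where "- x = a s + N s * j" using s(2) by (auto simp: residue_class_def)
      then have "a s + x = N s * - j" by simp
      then have "(a s + x) * c s = (N s * (int M div N s)) * (- j * m s)"
        by (simp add: c_def)
      then show ?thesis using N_dvd[OF s(1)] by simp
    qed
    then have "covering_function k a N (- x) \<le> card {s\<in>U. int M dvd (a s + x) * c s}"
      unfolding covering_function_def using \<open>finite U\<close> by (intro card_mono) (auto simp: U_def)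
    then show ?thesis
      using assms(7) card_T unfolding is_cover_def by (meson le_trans less_le_trans)
  qed
  have F: "of_int (F I) = 1 / (fact (p ^ n - 1) ^ l * fact (p ^ h - 1)) * (\<Prod>i\<in>T. b i + (\<Sum>s\<in>I. w i s))"
    if "I \<subseteq> U" "int M dvd sum c I" for I
  proof -
    have "finite I" using that(1) \<open>finite U\<close> by (rule finite_subset)
    have gbin: "(x gchoose r) = (\<Prod>j\<in>{0..<r}. x - of_nat j) / fact r" for x :: complex and r
      using gbinomial_mult_fact'[of x r] by (simp add: field_simps)
    have "b (Inl x) + (\<Sum>s\<in>I. w (Inl x) s) = of_int (int (d I (fst x)) - 1) - of_nat (snd x)" for x
      using \<open>finite I\<close>
      by (simp add: b_def w_def d_def sum.If_cases of_bool_def Int_def split: prod.split)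
    moreover have "b (Inr j) + (\<Sum>s\<in>I. w (Inr j) s) = of_int (sum c I div int M - 1) - of_nat j" for j
    proof -
      have "sum c I = int M * (sum c I div int M)" using that(2) by simp
      then have "of_int (sum c I) = (of_nat M * of_int (sum c I div int M) :: complex)"
        by (metis of_int_mult of_int_of_nat_eq)
      then show ?thesis
        using sum_c(1)[OF that(1)] \<open>M > 0\<close> by (simp add: b_def w_def)
    qed
    ultimately show ?thesis
      using \<open>finite (verts G)\<close> assms(3)
      by (simp add: F_def of_int_int_gbinomial gbin T_def prod.Plus prod_dividef split_def prod.cartesian_product
          del: of_int_diff)
  qed
  have "\<not> int p dvd (- 1) ^ e" for e
    using prime_gt_1_nat[OF assms(1)] by (auto simp: minus_one_power_iff)
  then have "\<not> int p dvd F {}"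
    by (auto simp: F_def d_def int_gbinomial_minus_one simp flip: power_mult power_add)
  moreover have "prime (int p)" using assms(1) by simp
  ultimately obtain I where I: "I \<subseteq> U" "I \<noteq> {}" "int M dvd sum c I" "\<not> int p dvd F I"
    using exists_nonempty_not_dvd[OF _ \<open>M > 0\<close> \<open>finite T\<close> \<open>finite U\<close> cover F] by metis
  have degree: "p ^ n dvd d I v" if "v \<in> verts G" for v
  proof (rule ccontr)
    assume "\<not> p ^ n dvd d I v"
    then have "int p dvd int_gbinomial (int (d I v) - 1) (p ^ n - 1)"
      using prime_dvd_int_gbinomial[OF assms(1)] by (metis int_dvd_int_iff)
    also have "\<dots> dvd F I"
      unfolding F_def using that \<open>finite (verts G)\<close> by (intro dvd_mult2 dvd_prodI)
    finally show False using I(4) by simp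
  qed
  have "int (p ^ h) dvd sum c I div int M"
  proof (rule ccontr)
    assume "\<not> int (p ^ h) dvd sum c I div int M"
    then have "int p dvd int_gbinomial (sum c I div int M - 1) (p ^ h - 1)"
      using prime_dvd_int_gbinomial[OF assms(1)] by blast
    with I(4) show False by (simp add: F_def)
  qed
  then obtain z where "sum c I div int M = int (p ^ h) * z" by (rule dvdE)
  moreover have "sum c I = int M * (sum c I div int M)" using I(3) by simp
  ultimately have z: "sum c I = int M * (int (p ^ h) * z)" by simp
  \<comment> \<open>Only endpoints of edges in \<open>I\<close> are kept, since an isolated vertex
    would have degree 0.\<close>
  define H where "H = \<lparr>verts = (\<Union>s\<in>I. ends G s), edges = I, ends = ends G\<rparr>"
  have ends: "ends G s \<subseteq> verts G" if "s \<in> U" for s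
    using assms(2,4) that by (auto simp: finite_loopless_multigraph_def U_def)
  have "I \<subseteq> edges G" using I(1) assms(4) by (simp add: U_def)
  moreover have "(\<Union>s\<in>I. ends G s) \<subseteq> verts G" using I(1) ends by blast
  ultimately have "subgraph H G"
    by (auto simp: subgraph_def H_def)
  moreover have "edges H \<noteq> {}" using I(2) by (simp add: H_def)
  moreover have "regular_multigraph (p ^ n) H"
    unfolding regular_multigraph_def
  proof
    fix v assume "v \<in> verts H"
    then obtain s where s: "s \<in> I" "v \<in> ends G s" by (auto simp: H_def)
    then have v: "v \<in> verts G" using ends I(1) by blast
    have "finite I" using I(1) \<open>finite U\<close> by (rule finite_subset)
    then have "d I v > 0" using s by (auto simp: d_def card_gt_0_iff)
    moreover have "d I v \<le> vertex_degree G v"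
      unfolding d_def vertex_degree_def using I(1) assms(4) by (intro card_mono) (auto simp: U_def)
    moreover have "vertex_degree G v \<le> 2 * p ^ n - 1" using assms(5) v by blast
    \<comment> \<open>Positivity of \<open>p ^ n\<close> makes the truncated
      \<open>2 * p ^ n - 1\<close> a strict bound.\<close>
    ultimately have "0 < d I v" "d I v < p ^ n * 2" using p_pos[of n] by linarith+
    moreover obtain q where "d I v = p ^ n * q" using degree[OF v] by (elim dvdE)
    ultimately have "0 < q" "q < 2" by simp_all
    then have "q = 1" by simp
    then show "vertex_degree H v = p ^ n"
      using \<open>d I v = p ^ n * q\<close> by (simp add: vertex_degree_def H_def d_def)
  qed
  moreover have "(\<Sum>s\<in>edges H. (of_int (m s) / of_int (N s) :: rat)) = of_nat (p ^ h) * of_int z"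
    using sum_c(2)[OF I(1)] \<open>M > 0\<close> by (simp add: H_def z)
  ultimately show ?thesis by blast
qed

end
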